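(* Let $N\ge 1$, let $\omega\in\mathbb{C}$ with $|\omega|=1$, and let $a_0,\dots,a_{N-1}\in\mathbb{C}$ with $|a_n|<1$ for $n=0,\dots,N-1$, and $a_N=\omega$, $a_{-1}=-1$. Let $\Phi_0,\dots,\Phi_{N+1}$ be the associated monic polynomials orthogonal on the unit circle (OPUC), $z_0,\dots,z_N$ the (distinct, unimodular) roots of $\Phi_{N+1}$, $w_0,\dots,w_N$ the associated weights, and $h_N=\prod_{k=0}^{N-1}(1-|a_k|^2)$. Then the OPUC are persymmetric, i.e. $a_n=-\omega\,\overline{a_{N-1-n}}$ for $n=0,1,\dots,N$, if and only if $$w_s=\frac{\sqrt{h_N}}{\left|\Phi_{N+1}'(z_s)\right|},\qquad s=0,1,\dots,N.$$
   Context: The monic polynomials are defined by $\Phi_0=1$ and the Szegő recurrence $\Phi_{n+1}(z)=z\Phi_n(z)-\overline{a_n}\,\Phi_n^*(z)$ for $n=0,\dots,N$, where $\Phi_n^*(z)=z^n\overline{\Phi}_n(1/z)$ and $\overline{\Phi}_n$ denotes the polynomial obtained from $\Phi_n$ by conjugating its coefficients. Since $|a_N|=1$, the polynomial $\Phi_{N+1}$ has $N+1$ distinct roots $z_0,\dots,z_N$ on the unit circle. The weights are $$w_s=\frac{h_N}{\Phi_{N+1}'(z_s)\,\overline{\Phi}_N(z_s^{-1})},\qquad s=0,\dots,N;$$ they are positive, and $\sum_{s=0}^N w_s\Phi_n(z_s)\overline{\Phi}_m(z_s^{-1})=h_n\delta_{nm}$ for $0\le n,m\le N$, with $h_n=\prod_{k=0}^{n-1}(1-|a_k|^2)$,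 $h_0=1$. *)

theory Defs
  imports Complex_Main "HOL-Computational_Algebra.Polynomial"
begin

text \<open>
  The recurrence coefficients are indexed by \<^typ>\<open>int\<close> so that the convention
  $a_{-1} = -1$ can be stated as a hypothesis on the sequence itself.
\<close>

abbreviation conj_poly :: "complex poly \<Rightarrow> complex poly" where
  "conj_poly p \<equiv> map_poly cnj p"

text \<open>
  \<^const>\<open>reflect_poly\<close> reverses the coefficients of \<open>p\<close> with respect to its actual degree.
  The polynomial \<open>opuc a n\<close> has degree \<open>n\<close> (lemma \<open>degree_opuc\<close>), so for it
  \<open>rev_poly\<close> is $z^n \overline{\Phi}_n(1/z)$ (lemma \<open>poly_rev_opuc\<close>).
\<close>

definition rev_poly :: "complex poly \<Rightarrow> complex poly" where
  "rev_poly p = reflect_poly (conj_poly p)"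

primrec opuc :: "(int \<Rightarrow> complex) \<Rightarrow> nat \<Rightarrow> complex poly" where
  "opuc a 0 = 1"
| "opuc a (Suc n) = [:0, 1:] * opuc a n - smult (cnj (a (int n))) (rev_poly (opuc a n))"

definition opuc_h :: "(int \<Rightarrow> complex) \<Rightarrow> nat \<Rightarrow> real" where
  "opuc_h a n = (\<Prod>k<n. 1 - (cmod (a (int k)))\<^sup>2)"

definition opuc_weight :: "(int \<Rightarrow> complex) \<Rightarrow> nat \<Rightarrow> complex \<Rightarrow> complex" where
  "opuc_weight a N x =
     complex_of_real (opuc_h a N) /
       (poly (pderiv (opuc a (Suc N))) x * poly (conj_poly (opuc a N)) (inverse x))"

definition opuc_persymmetric :: "(int \<Rightarrow> complex) \<Rightarrow> nat \<Rightarrow> complex \<Rightarrow> bool" where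
  "opuc_persymmetric a N \<omega> \<longleftrightarrow> (\<forall>n\<in>{0..int N}. a n = - \<omega> * cnj (a (int N - 1 - n)))"

lemma degree_conj_poly: "degree (conj_poly p) = degree p"
  by (rule degree_map_poly) simp

lemma degree_lead_coeff_opuc: "degree (opuc a n) = n \<and> lead_coeff (opuc a n) = 1"
proof (induction n)
  case 0
  show ?case by simp
next
  case (Suc n)
  let ?p = "opuc a n" and ?q = "smult (cnj (a (int n))) (rev_poly (opuc a n))"
  from Suc have nz: "?p \<noteq> 0" by auto
  have "degree ?q \<le> degree (conj_poly ?p)"
    unfolding rev_poly_def by (rule order_trans[OF degree_smult_le degree_reflect_poly_le])
  with Suc have q: "degree ?q \<le> n" by (simp add: degree_conj_poly)
  from nz Suc have d: "degree (pCons 0 ?p) = Suc n" by simp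
  have c: "coeff (opuc a (Suc n)) (Suc n) = 1"
  proof -
    have "coeff ?p n = 1"
      using Suc by metis
    moreover have "coeff ?q (Suc n) = 0"
      using q by (intro coeff_eq_0) simp
    ultimately show ?thesis
      by (simp del: coeff_smult)
  qed
  have "degree (opuc a (Suc n)) \<le> Suc n"
    using degree_diff_le[of "pCons 0 ?p" "Suc n" ?q] d q by simp
  moreover have "Suc n \<le> degree (opuc a (Suc n))"
    using c by (intro le_degree) simp
  ultimately have "degree (opuc a (Suc n)) = Suc n"
    by (rule order_antisym)
  with c show ?case by (metis (no_types))
qed

lemma degree_opuc: "degree (opuc a n) = n"
  using degree_lead_coeff_opuc by blast

lemma poly_rev_opuc:
  assumes "x \<noteq> 0"
  shows "poly (rev_poly (opuc a n)) x = x ^ n * poly (conj_poly (opuc a n)) (1 / x)"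
  using assms
  by (simp add: rev_poly_def poly_reflect_poly_nz degree_conj_poly degree_opuc inverse_eq_divide)

end

theory Submission
  imports Defs
begin

text \<open>
  Let \<open>b\<^sub>n = - \<omega> cnj a\<^bsub>N-1-n\<^esub>\<close> be the mirrored coefficients and \<open>\<Phi>\<^sup>b\<close> their OPUC.
  Reading the product of Szego transfer matrices from the other end shows that
  $\Phi_{N+1} = \Phi^b_{N+1}$, and pairing with the second-kind polynomials (coefficients \<open>- a\<^sub>n\<close>)
  gives $\overline{\Phi_N(z_s)}\, \Phi^b_N(z_s) = h_N$ at every root. By positivity the weight
  formula says $|\Phi_N(z_s)|^2 = h_N$ for all \<open>s\<close>, that is $\Phi_N = \Phi^b_N$ at $N+1$ points,
  hence identically; since \<open>\<Phi>\<^sub>N\<close> determines its coefficients, this is \<open>a = b\<close>.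
\<close>

section \<open>Szego recurrence for the reversed polynomials\<close>

lemma poly_opuc_Suc:
  "poly (opuc a (Suc n)) x =
     x * poly (opuc a n) x - cnj (a (int n)) * poly (rev_poly (opuc a n)) x"
  by simp

text \<open>Coefficient reversal depends on the actual degree and does not distribute over
  differences, so the dual recurrence is checked by values at nonzero \<open>x\<close>, using the
  reflection of \<open>x\<close> in the unit circle. Infinitely many points of agreement then
  suffice.\<close>

lemma rev_poly_opuc_Suc:
  "rev_poly (opuc a (Suc n)) = rev_poly (opuc a n) - smult (a (int n)) ([:0, 1:] * opuc a n)"
  (is "?l = ?r")
proof -
  have eq: "poly ?l x = poly ?r x" if x: "x \<noteq> 0" for x
  proof -
    let ?y = "cnj (1 / x)"
    have y: "?y \<noteq> 0" "1 / ?y = cnj x" using x by auto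
    have rev: "poly (rev_poly (opuc a n)) ?y = ?y ^ n * cnj (poly (opuc a n) x)"
      using poly_rev_opuc[OF y(1), of a n] y(2) by (simp add: poly_map_poly_cnj)
    have "poly ?l x = x ^ Suc n * cnj (poly (opuc a (Suc n)) ?y)"
      using poly_rev_opuc[OF x, of a "Suc n"] by (simp only: poly_map_poly_cnj)
    also have "\<dots> = x ^ n * cnj (poly (opuc a n) ?y) - a (int n) * x * poly (opuc a n) x"
      unfolding poly_opuc_Suc rev using x by (simp add: field_simps)
    also have "x ^ n * cnj (poly (opuc a n) ?y) = poly (rev_poly (opuc a n)) x"
      using poly_rev_opuc[OF x, of a n] by (simp only: poly_map_poly_cnj)
    finally show ?thesis by simp
  qed
  have "?l - ?r = 0"
  proof (rule ccontr)
    assume "?l - ?r \<noteq> 0"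
    then have "finite {x. poly (?l - ?r) x = 0}" by (rule poly_roots_finite)
    moreover have "- {0} \<subseteq> {x. poly (?l - ?r) x = 0}" using eq by auto
    ultimately have "finite (- {0 :: complex})" by (rule rev_finite_subset)
    then have "finite (UNIV :: complex set)" by (simp add: Compl_eq_Diff_UNIV)
    then show False using infinite_UNIV_char_0 by blast
  qed
  then show ?thesis by simp
qed

lemma rev_poly_opuc_0: "rev_poly (opuc a 0) = 1"
  by (simp add: rev_poly_def)

lemma poly_rev_opuc_Suc:
  "poly (rev_poly (opuc a (Suc n))) x =
     poly (rev_poly (opuc a n)) x - a (int n) * x * poly (opuc a n) x"
  unfolding rev_poly_opuc_Suc by simp

declare opuc.simps(2) [simp del]

lemma poly_rev_opuc_at_0: "poly (rev_poly (opuc a n)) 0 = 1"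
  by (induction n) (simp_all add: rev_poly_opuc_0[simplified] poly_rev_opuc_Suc)

lemma poly_rev_opuc_unit:
  assumes "cmod x = 1"
  shows "poly (rev_poly (opuc a n)) x = x ^ n * cnj (poly (opuc a n) x)"
proof -
  have x: "x \<noteq> 0" using assms by auto
  have "x * cnj x = 1" using assms by (simp only: complex_norm_square[symmetric]) simp
  then have "cnj (1 / x) = x" using x by (simp add: field_simps)
  then show ?thesis using poly_rev_opuc[OF x, of a n] by (simp only: poly_map_poly_cnj)
qed

section \<open>Coefficients and polynomials determine each other\<close>

lemma opuc_cong:
  assumes "\<And>k. k < n \<Longrightarrow> a (int k) = b (int k)"
  shows "opuc a n = opuc b n"
  using assms by (induction n) (simp_all add: opuc.simps(2))

text \<open>The top coefficient is read off from the value at 0, where the reversed polynomial is 1.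
  The inverse recurrence \<open>inv\<close> then recovers the previous polynomial, so the argument
  descends; the bound on \<open>a\<close> lets the factor \<open>1 - |a n|^2\<close> be
  cancelled.\<close>

lemma opuc_inject:
  assumes "opuc a n = opuc b n"
    and "\<And>k. k < n \<Longrightarrow> cmod (a (int k)) < 1"
    and "k < n"
  shows "a (int k) = b (int k)"
  using assms
proof (induction n)
  case (Suc n)
  have "cnj (a (int n)) = cnj (b (int n))"
    using arg_cong[OF Suc.prems(1), of "\<lambda>p. poly p 0"]
    by (simp add: poly_opuc_Suc poly_rev_opuc_at_0)
  then have ab: "a (int n) = b (int n)" by (simp only: complex_cnj_cancel_iff)
  have inv: "smult (1 - c (int n) * cnj (c (int n))) ([:0, 1:] * opuc c n) =
      opuc c (Suc n) + smult (cnj (c (int n))) (rev_poly (opuc c (Suc n)))" for c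
    unfolding rev_poly_opuc_Suc unfolding opuc.simps(2)
    by (simp add: algebra_simps smult_diff_right smult_diff_left)
  have "1 - a (int n) * cnj (a (int n)) \<noteq> 0"
  proof -
    have "(cmod (a (int n)))\<^sup>2 < 1" using Suc.prems(2)[of n] by (simp add: power_less_one_iff abs_square_less_1)
    then have "complex_of_real ((cmod (a (int n)))\<^sup>2) \<noteq> 1"
      by (metis less_irrefl of_real_eq_1_iff)
    then show ?thesis unfolding complex_norm_square[symmetric] by simp
  qed
  moreover have "smult (1 - a (int n) * cnj (a (int n))) ([:0, 1:] * (opuc a n - opuc b n)) = 0"
    using inv[of a] inv[of b] Suc.prems(1) ab
    by (simp only: right_diff_distrib smult_diff_right diff_self)
  ultimately have "opuc a n = opuc b n" by simp
  with Suc ab show ?case by (metis less_Suc_eq)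
qed simp

section \<open>Second-kind polynomials and the mirrored recurrence\<close>

lemma opuc_h_pos:
  assumes "\<And>k. k < n \<Longrightarrow> cmod (a (int k)) < 1"
  shows "opuc_h a n > 0"
  unfolding opuc_h_def using assms by (intro prod_pos) (simp add: abs_square_less_1)

lemma opuc_h_Suc: "opuc_h a (Suc n) = opuc_h a n * (1 - (cmod (a (int n)))\<^sup>2)"
  by (simp add: opuc_h_def)

text \<open>With a minus sign on its reversed component, the second-kind pair solves the same
  recurrence as the first. Up to sign the left side is the determinant of these two solutions: it
  starts at 2, and each transfer matrix has determinant \<open>x * (1 - |a n|^2)\<close>.\<close>

lemma opuc_second_kind_det:
  fixes a :: "int \<Rightarrow> complex" and n :: nat and x :: complex
  defines "\<psi> \<equiv> opuc (\<lambda>k. - a k)"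
  shows "poly (opuc a n) x * poly (rev_poly (\<psi> n)) x + poly (\<psi> n) x * poly (rev_poly (opuc a n)) x
    = 2 * x ^ n * complex_of_real (opuc_h a n)"
proof (induction n)
  case 0
  show ?case by (simp add: \<psi>_def rev_poly_opuc_0[simplified] opuc_h_def)
next
  case (Suc n)
  let ?L = "poly (opuc a n) x * poly (rev_poly (\<psi> n)) x + poly (\<psi> n) x * poly (rev_poly (opuc a n)) x"
  have "poly (opuc a (Suc n)) x * poly (rev_poly (\<psi> (Suc n))) x
      + poly (\<psi> (Suc n)) x * poly (rev_poly (opuc a (Suc n))) x
      = x * (1 - a (int n) * cnj (a (int n))) * ?L"
    unfolding \<psi>_def poly_opuc_Suc poly_rev_opuc_Suc by (simp add: algebra_simps)
  also have "\<dots> = 2 * x ^ Suc n * complex_of_real (opuc_h a (Suc n))"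
    unfolding Suc opuc_h_Suc of_real_mult of_real_diff complex_norm_square by simp
  finally show ?case .
qed

text \<open>
  The row vector $(x\,\Phi^b_{N-n}, -\overline\omega\,\Phi^{b*}_{N-n})$ is the product of
  $(x, -\overline\omega)$ with the transfer matrices of steps \<open>n, \<dots>, N - 1\<close>, so its pairing with
  any solution \<open>(p, q)\<close> of the recurrence does not depend on \<open>n\<close>.
\<close>

lemma mirror_pairing:
  assumes "\<omega> * cnj \<omega> = 1"
    and b: "\<And>k. b k = - \<omega> * cnj (a (int N - 1 - k))"
    and p: "\<And>n. p (Suc n) = x * p n - cnj (a (int n)) * q n"
    and q: "\<And>n. q (Suc n) = q n - a (int n) * x * p n"
    and "n \<le> N"
  shows "x * poly (opuc b (N - n)) x * p n - cnj \<omega> * poly (rev_poly (opuc b (N - n))) x * q n =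
    x * poly (opuc b N) x * p 0 - cnj \<omega> * poly (rev_poly (opuc b N)) x * q 0"
  using \<open>n \<le> N\<close>
proof (induction n)
  case (Suc n)
  \<comment> \<open>Since \<open>m = N - 1 - n\<close>, step \<open>m\<close> of the mirrored
    recurrence uses the coefficient that step \<open>n\<close> of the original one uses.\<close>
  define m where "m = N - Suc n"
  have m: "N - n = Suc m" "N - Suc n = m" "int N - 1 - int m = int n"
    using Suc.prems by (auto simp: m_def)
  have bm: "b (int m) = - \<omega> * cnj (a (int n))" using b[of "int m"] m(3) by simp
  let ?P = "poly (opuc b m) x" and ?Q = "poly (rev_poly (opuc b m)) x"
  have "x * poly (opuc b (Suc m)) x * p n - cnj \<omega> * poly (rev_poly (opuc b (Suc m))) x * q n
      = x * (x * ?P + cnj \<omega> * a (int n) * ?Q) * p n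
        - (cnj \<omega> * ?Q + (\<omega> * cnj \<omega>) * cnj (a (int n)) * x * ?P) * q n"
    unfolding poly_opuc_Suc poly_rev_opuc_Suc bm by (simp add: algebra_simps)
  also have "\<dots> = x * ?P * p (Suc n) - cnj \<omega> * ?Q * q (Suc n)"
    unfolding assms(1) p q by (simp add: algebra_simps)
  finally show ?case using Suc by (simp add: m)
qed simp

text \<open>The pairing is compared at its two ends for both solutions. If
  \<open>a N = \<omega>\<close>, then \<open>root\<close> says that \<open>x\<close> is a zero of
  the polynomial of degree \<open>N + 1\<close>; it forces \<open>?A = ?B\<close>, so the
  second-kind comparison yields \<open>2 * ?A\<close>, and the determinant identity
  finishes.\<close>

lemma mirror_product:
  assumes \<omega>: "\<omega> * cnj \<omega> = 1"
    and b: "\<And>k. b k = - \<omega> * cnj (a (int N - 1 - k))"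
    and root: "x * poly (opuc a N) x = cnj \<omega> * poly (rev_poly (opuc a N)) x"
  shows "poly (rev_poly (opuc a N)) x * poly (opuc b N) x = x ^ N * complex_of_real (opuc_h a N)"
proof -
  let ?\<psi> = "opuc (\<lambda>k. - a k)"
  let ?P = "poly (opuc a N) x" and ?Q = "poly (rev_poly (opuc a N)) x"
  let ?S = "poly (?\<psi> N) x" and ?T = "poly (rev_poly (?\<psi> N)) x"
  let ?A = "x * poly (opuc b N) x" and ?B = "cnj \<omega> * poly (rev_poly (opuc b N)) x"
  have "x * ?P - cnj \<omega> * ?Q = ?A - ?B"
    using mirror_pairing[of \<omega> b a N "\<lambda>n. poly (opuc a n) x" x
        "\<lambda>n. poly (rev_poly (opuc a n)) x" N, OF \<omega> b poly_opuc_Suc poly_rev_opuc_Suc order_refl]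
    by (simp add: rev_poly_opuc_0[simplified])
  moreover have "x * ?S + cnj \<omega> * ?T = ?A + ?B"
    using mirror_pairing[of \<omega> b a N "\<lambda>n. poly (?\<psi> n) x" x
        "\<lambda>n. - poly (rev_poly (?\<psi> n)) x" N, OF \<omega> b _ _ order_refl]
    by (simp add: rev_poly_opuc_0[simplified] poly_opuc_Suc poly_rev_opuc_Suc)
  ultimately have sum: "x * ?S + cnj \<omega> * ?T = 2 * ?A" using root by simp
  have Q: "?Q = \<omega> * (x * ?P)" unfolding root using \<omega> by (simp flip: mult.assoc)
  \<comment> \<open>The factor \<open>\<omega> * ?P\<close> is chosen so that \<open>root\<close>
    turns the left side into the determinant expression.\<close>
  have "\<omega> * ?P * (x * ?S + cnj \<omega> * ?T) = \<omega> * cnj \<omega> * ?P * ?T + ?S * (\<omega> * (x * ?P))"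
    by (simp add: algebra_simps)
  also have "\<dots> = ?P * ?T + ?S * ?Q" unfolding \<omega> Q by simp
  also have "\<dots> = 2 * x ^ N * complex_of_real (opuc_h a N)" by (rule opuc_second_kind_det)
  finally have "2 * (\<omega> * (x * ?P) * poly (opuc b N) x) = 2 * (x ^ N * complex_of_real (opuc_h a N))"
    unfolding sum by (simp add: algebra_simps)
  then show ?thesis unfolding Q by simp
qed

section \<open>Location of the zeros\<close>

text \<open>The quotient of the two polynomials stays bounded by 1 because each step multiplies it
  by \<open>x\<close> and applies a disc automorphism. Nonvanishing is carried along to keep the
  estimate strict in the next step.\<close>

lemma norm_opuc_le_rev:
  assumes "\<And>k. k < n \<Longrightarrow> cmod (a (int k)) < 1" and "cmod x \<le> 1"
  shows "cmod (poly (opuc a n) x) \<le> cmod (poly (rev_poly (opuc a n)) x)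
    \<and> poly (rev_poly (opuc a n)) x \<noteq> 0"
  using assms(1)
proof (induction n)
  case (Suc n)
  let ?P = "poly (opuc a n) x" and ?Q = "poly (rev_poly (opuc a n)) x" and ?a = "a (int n)"
  have IH: "cmod ?P \<le> cmod ?Q" "?Q \<noteq> 0" and a: "cmod ?a < 1" using Suc by auto
  have xP: "cmod (x * ?P) \<le> cmod ?Q"
    using mult_mono[of "cmod x" 1 "cmod ?P" "cmod ?Q"] IH assms(2) by (simp add: norm_mult)
  have "cmod ?a * cmod (x * ?P) \<le> cmod ?a * cmod ?Q" by (intro mult_left_mono xP) simp
  also have "\<dots> < cmod ?Q" using a IH by simp
  finally have "?Q \<noteq> ?a * (x * ?P)" by (auto simp: norm_mult)
  moreover have "(cmod (x * ?P - cnj ?a * ?Q))\<^sup>2 \<le> (cmod (?Q - ?a * (x * ?P)))\<^sup>2"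
  proof -
    \<comment> \<open>This is the Schwarz-Pick identity for the disc automorphism with parameter
      \<open>cnj ?a\<close>.\<close>
    have "complex_of_real ((cmod (?Q - ?a * (x * ?P)))\<^sup>2 - (cmod (x * ?P - cnj ?a * ?Q))\<^sup>2) =
      complex_of_real ((1 - (cmod ?a)\<^sup>2) * ((cmod ?Q)\<^sup>2 - (cmod (x * ?P))\<^sup>2))"
      unfolding of_real_mult of_real_diff complex_norm_square by (simp add: algebra_simps)
    moreover have "(1 - (cmod ?a)\<^sup>2) * ((cmod ?Q)\<^sup>2 - (cmod (x * ?P))\<^sup>2) \<ge> 0"
      using a xP by (intro mult_nonneg_nonneg) (auto simp: abs_square_le_1 power_mono)
    ultimately show ?thesis by (simp only: of_real_eq_iff)
  qed
  ultimately show ?case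
    by (simp add: poly_opuc_Suc poly_rev_opuc_Suc mult.assoc power2_le_iff_abs_le)
qed (simp add: rev_poly_opuc_0[simplified])

text \<open>As \<open>|a N| = 1\<close>, a zero gives equal moduli, which is impossible in the open
  disc by the previous bound. A zero outside is reflected to a zero of the reversed polynomial
  inside, with the same contradiction.\<close>

lemma cmod_opuc_root:
  assumes a: "\<And>k. k < N \<Longrightarrow> cmod (a (int k)) < 1" and aN: "cmod (a (int N)) = 1"
    and root: "poly (opuc a (Suc N)) x = 0"
  shows "cmod x = 1"
proof -
  have inside: False
    if y: "cmod y < 1" and eq: "cmod (y * poly (opuc a N) y) = cmod (poly (rev_poly (opuc a N)) y)" for y
  proof -
    have le: "cmod (poly (opuc a N) y) \<le> cmod (poly (rev_poly (opuc a N)) y)"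
      and nz: "poly (rev_poly (opuc a N)) y \<noteq> 0"
      using norm_opuc_le_rev[of N a y] a y by auto
    have "cmod (y * poly (opuc a N) y) \<le> cmod y * cmod (poly (rev_poly (opuc a N)) y)"
      using le by (simp add: norm_mult mult_left_mono)
    also have "\<dots> < cmod (poly (rev_poly (opuc a N)) y)" using y nz by simp
    finally show False using eq by simp
  qed
  have "\<not> cmod x < 1"
  proof
    assume "cmod x < 1"
    moreover have "x * poly (opuc a N) x = cnj (a (int N)) * poly (rev_poly (opuc a N)) x"
      using root by (simp add: poly_opuc_Suc)
    then have "cmod (x * poly (opuc a N) x) = cmod (poly (rev_poly (opuc a N)) x)"
      using aN by (simp add: norm_mult)
    ultimately show False by (rule inside)
  qed
  moreover have "\<not> cmod x > 1"
  proof
    let ?y = "cnj (1 / x)"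
    assume x: "cmod x > 1"
    then have "x \<noteq> 0" by auto
    then have y: "?y \<noteq> 0" "cnj (1 / ?y) = x" by auto
    have "poly (rev_poly (opuc a (Suc N))) ?y = 0"
      using poly_rev_opuc[OF y(1), of a "Suc N"] y(2) root by (simp only: poly_map_poly_cnj) simp
    then have "poly (rev_poly (opuc a N)) ?y = a (int N) * (?y * poly (opuc a N) ?y)"
      by (simp add: poly_rev_opuc_Suc)
    then have "cmod (?y * poly (opuc a N) ?y) = cmod (poly (rev_poly (opuc a N)) ?y)"
      using aN by (simp only: norm_mult mult_1)
    moreover have "cmod ?y < 1" using x by (simp add: norm_divide divide_less_eq)
    ultimately show False using inside by blast
  qed
  ultimately show ?thesis by simp
qed

section \<open>Positivity of the weights\<close>

text \<open>
  On the unit circle the Wronskian below is $x^{n-1} G_n$ with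
  $G_{n+1} = (1 - |a_n|^2)(G_n + |\Phi_n|^2)$ and \<open>G\<^sub>0 = 0\<close>.
\<close>

lemma opuc_wronskian:
  assumes "\<And>k. k < n \<Longrightarrow> cmod (a (int k)) < 1" and x: "cmod x = 1"
  shows "\<exists>G::real. G \<ge> 0 \<and>
    x * (poly (pderiv (opuc a n)) x * poly (rev_poly (opuc a n)) x
         - poly (opuc a n) x * poly (pderiv (rev_poly (opuc a n))) x) = x ^ n * complex_of_real G"
  using assms(1)
proof (induction n)
  case 0
  show ?case by (intro exI[of _ 0]) (simp add: rev_poly_opuc_0[simplified])
next
  case (Suc n)
  let ?v = "poly (opuc a n) x" and ?V = "poly (rev_poly (opuc a n)) x" and ?a = "a (int n)"
  let ?v' = "poly (pderiv (opuc a n)) x" and ?V' = "poly (pderiv (rev_poly (opuc a n))) x"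
  obtain G :: real where G: "G \<ge> 0" "x * (?v' * ?V - ?v * ?V') = x ^ n * complex_of_real G"
    using Suc by auto
  have vV: "?v * ?V = x ^ n * complex_of_real ((cmod ?v)\<^sup>2)"
    unfolding complex_norm_square by (simp add: poly_rev_opuc_unit[OF x])
  let ?r = "1 - (cmod ?a)\<^sup>2"
  have "poly (pderiv (opuc a (Suc n))) x * poly (rev_poly (opuc a (Suc n))) x
         - poly (opuc a (Suc n)) x * poly (pderiv (rev_poly (opuc a (Suc n)))) x
      = complex_of_real ?r * (x * (?v' * ?V - ?v * ?V') + ?v * ?V)"
    unfolding of_real_diff complex_norm_square rev_poly_opuc_Suc
    unfolding opuc.simps(2) by (simp add: pderiv_diff pderiv_smult pderiv_pCons algebra_simps)
  also have "\<dots> = x ^ n * complex_of_real (?r * (G + (cmod ?v)\<^sup>2))"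
    unfolding G(2) vV by (simp add: algebra_simps)
  finally have "x * (poly (pderiv (opuc a (Suc n))) x * poly (rev_poly (opuc a (Suc n))) x
         - poly (opuc a (Suc n)) x * poly (pderiv (rev_poly (opuc a (Suc n)))) x)
      = x ^ Suc n * complex_of_real (?r * (G + (cmod ?v)\<^sup>2))" by simp
  moreover have "?r * (G + (cmod ?v)\<^sup>2) \<ge> 0"
    using Suc.prems[of n] G(1) by (intro mult_nonneg_nonneg) (auto simp: abs_square_le_1)
  ultimately show ?case by blast
qed

text \<open>On the circle \<open>inverse x = cnj x\<close>, so this is the denominator of the
  weight. The root equation turns it, up to the factor \<open>x ^ N\<close>, into
  \<open>|?v|^2\<close> plus the nonnegative Wronskian term \<open>G\<close>.\<close>

lemma opuc_weight_denominator_pos: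
  assumes a: "\<And>k. k < N \<Longrightarrow> cmod (a (int k)) < 1" and x: "cmod x = 1"
    and root: "poly (opuc a (Suc N)) x = 0"
  shows "\<exists>r::real. r > 0 \<and>
    poly (pderiv (opuc a (Suc N))) x * cnj (poly (opuc a N) x) = complex_of_real r"
proof -
  let ?v = "poly (opuc a N) x" and ?V = "poly (rev_poly (opuc a N)) x" and ?a = "a (int N)"
  let ?v' = "poly (pderiv (opuc a N)) x" and ?V' = "poly (pderiv (rev_poly (opuc a N))) x"
  have V: "?V = x ^ N * cnj ?v" by (rule poly_rev_opuc_unit[OF x])
  have "?V \<noteq> 0" using norm_opuc_le_rev[of N a x] a x by auto
  then have v: "?v \<noteq> 0" using V by auto
  have x0: "x \<noteq> 0" using x by auto
  obtain G :: real where G: "G \<ge> 0" "x * (?v' * ?V - ?v * ?V') = x ^ N * complex_of_real G"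
    using opuc_wronskian[of N a x] a x by auto
  have eq: "cnj ?a * ?V = x * ?v" using root by (simp add: poly_opuc_Suc)
  have "poly (pderiv (opuc a (Suc N))) x * ?V = ?v * ?V + x * ?v' * ?V - (cnj ?a * ?V) * ?V'"
    by (simp add: opuc.simps(2) pderiv_diff pderiv_smult pderiv_pCons algebra_simps)
  also have "\<dots> = ?v * ?V + x * (?v' * ?V - ?v * ?V')" unfolding eq by (simp add: algebra_simps)
  also have "\<dots> = x ^ N * complex_of_real ((cmod ?v)\<^sup>2 + G)"
    unfolding G(2) unfolding of_real_add complex_norm_square V by (simp add: algebra_simps)
  finally have "x ^ N * (poly (pderiv (opuc a (Suc N))) x * cnj ?v) =
      x ^ N * complex_of_real ((cmod ?v)\<^sup>2 + G)"
    unfolding V by (simp only: mult_ac)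
  then have "poly (pderiv (opuc a (Suc N))) x * cnj ?v = complex_of_real ((cmod ?v)\<^sup>2 + G)"
    using x0 by (simp only: mult_cancel_left power_not_zero if_False simp_thms)
  moreover have "(cmod ?v)\<^sup>2 + G > 0" using v G(1) by (simp add: add_pos_nonneg)
  ultimately show ?thesis by blast
qed

text \<open>A positive denominator equals the product of the moduli of its factors; the derivative
  then cancels, leaving \<open>cmod ?v = sqrt ?h\<close>.\<close>

lemma opuc_weight_eq_iff:
  assumes a: "\<And>k. k < N \<Longrightarrow> cmod (a (int k)) < 1" and x: "cmod x = 1"
    and root: "poly (opuc a (Suc N)) x = 0"
  shows "opuc_weight a N x =
      complex_of_real (sqrt (opuc_h a N) / cmod (poly (pderiv (opuc a (Suc N))) x)) \<longleftrightarrow>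
    poly (opuc a N) x * cnj (poly (opuc a N) x) = complex_of_real (opuc_h a N)"
proof -
  let ?h = "opuc_h a N" and ?D = "poly (pderiv (opuc a (Suc N))) x" and ?v = "poly (opuc a N) x"
  obtain r :: real where r: "r > 0" "?D * cnj ?v = complex_of_real r"
    using opuc_weight_denominator_pos[of N a x] a x root by blast
  have h: "?h > 0" using a by (intro opuc_h_pos)
  have pos: "cmod ?D > 0" "cmod ?v > 0" using r by auto
  have "cmod (?D * cnj ?v) = r" unfolding r(2) using r(1) by simp
  then have rD: "r = cmod ?D * cmod ?v" by (simp add: norm_mult)
  have "x * cnj x = 1" using x unfolding complex_norm_square[symmetric] by simp
  moreover have "x \<noteq> 0" using x by auto
  ultimately have "cnj (inverse x) = x" by (simp add: field_simps)
  then have "opuc_weight a N x = complex_of_real (?h / r)"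
    unfolding opuc_weight_def by (simp only: poly_map_poly_cnj r(2) of_real_divide)
  then have "opuc_weight a N x = complex_of_real (sqrt ?h / cmod ?D) \<longleftrightarrow> ?h / r = sqrt ?h / cmod ?D"
    by (simp only: of_real_eq_iff)
  also have "\<dots> \<longleftrightarrow> ?h = sqrt ?h * cmod ?v"
    using pos unfolding rD by (simp add: divide_eq_eq)
  also have "\<dots> \<longleftrightarrow> sqrt ?h * sqrt ?h = sqrt ?h * cmod ?v"
    using h by simp
  also have "\<dots> \<longleftrightarrow> sqrt ?h = cmod ?v"
    using h by (simp only: mult_cancel_left) simp
  also have "\<dots> \<longleftrightarrow> (cmod ?v)\<^sup>2 = ?h"
    using h by (metis less_imp_le norm_ge_zero real_sqrt_pow2 real_sqrt_unique)
  also have "\<dots> \<longleftrightarrow> ?v * cnj ?v = complex_of_real ?h"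
    by (simp only: complex_norm_square[symmetric] of_real_eq_iff)
  finally show ?thesis .
qed

theorem proposition5p2:
  fixes N :: nat and \<omega> :: complex and a :: "int \<Rightarrow> complex" and z :: "nat \<Rightarrow> complex"
  assumes "N \<ge> 1"
    and "cmod \<omega> = 1"
    and "\<And>n. 0 \<le> n \<Longrightarrow> n < int N \<Longrightarrow> cmod (a n) < 1"
    and "a (int N) = \<omega>"
    and "a (-1) = -1"
    and "bij_betw z {0..N} {x. poly (opuc a (N + 1)) x = 0}"
  shows "opuc_persymmetric a N \<omega> \<longleftrightarrow>
    (\<forall>s\<in>{0..N}. opuc_weight a N (z s) =
       complex_of_real (sqrt (opuc_h a N) / cmod (poly (pderiv (opuc a (N + 1))) (z s))))"
proof -
  define b where "b = (\<lambda>k. - \<omega> * cnj (a (int N - 1 - k)))"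
  define R where "R = {x. poly (opuc a (Suc N)) x = 0}"
  have a: "cmod (a (int k)) < 1" if "k < N" for k using assms(3) that by simp
  have \<omega>: "\<omega> * cnj \<omega> = 1" using assms(2) unfolding complex_norm_square[symmetric] by simp
  have z: "bij_betw z {0..N} R" using assms(6) by (simp add: R_def)
  then have card: "card R = Suc N" using bij_betw_same_card by fastforce
  have weight_iff: "opuc_weight a N x =
      complex_of_real (sqrt (opuc_h a N) / cmod (poly (pderiv (opuc a (N + 1))) x)) \<longleftrightarrow>
    poly (opuc a N) x = poly (opuc b N) x" if "x \<in> R" for x
  proof -
    let ?v = "poly (opuc a N) x"
    have root: "poly (opuc a (Suc N)) x = 0" using that by (simp add: R_def)
    have x: "cmod x = 1" using cmod_opuc_root[of N a x] a assms(2,4) root by simp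
    then have x0: "x \<noteq> 0" by auto
    have "x * ?v = cnj \<omega> * poly (rev_poly (opuc a N)) x"
      using root assms(4) by (simp add: poly_opuc_Suc)
    then have "poly (rev_poly (opuc a N)) x * poly (opuc b N) x = x ^ N * complex_of_real (opuc_h a N)"
      by (intro mirror_product[OF \<omega>]) (simp_all only: b_def)
    then have "x ^ N * (poly (opuc b N) x * cnj ?v) = x ^ N * complex_of_real (opuc_h a N)"
      by (simp only: poly_rev_opuc_unit[OF x] mult_ac)
    then have prod: "poly (opuc b N) x * cnj ?v = complex_of_real (opuc_h a N)"
      using x0 by simp
    have "opuc_h a N > 0" using a by (intro opuc_h_pos)
    then have "cnj ?v \<noteq> 0" using prod by auto
    \<comment> \<open>By \<open>prod\<close>, both \<open>?v\<close> and the mirrored value are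
      compared after multiplication by the same nonzero number \<open>cnj ?v\<close>.\<close>
    then have "?v * cnj ?v = complex_of_real (opuc_h a N) \<longleftrightarrow> ?v = poly (opuc b N) x"
      unfolding prod[symmetric] by (rule mult_right_cancel)
    then show ?thesis using opuc_weight_eq_iff[of N a x] a x root by simp
  qed
  \<comment> \<open>The condition at index \<open>N\<close> reads
    \<open>a N = - \<omega> * cnj (a (-1))\<close> and holds by the convention
    \<open>a (-1) = -1\<close>, so only \<open>k < N\<close> remains.\<close>
  have "opuc_persymmetric a N \<omega> \<longleftrightarrow> (\<forall>k<N. a (int k) = b (int k))"
  proof
    assume "opuc_persymmetric a N \<omega>"
    then have "a n = b n" if "n \<in> {0..int N}" for n
      using that unfolding opuc_persymmetric_def b_def by blast
    then show "\<forall>k<N. a (int k) = b (int k)" by simp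
  next
    assume eq: "\<forall>k<N. a (int k) = b (int k)"
    show "opuc_persymmetric a N \<omega>"
      unfolding opuc_persymmetric_def
    proof
      fix n assume "n \<in> {0..int N}"
      then consider "n = int N" | k where "n = int k" "k < N"
        by (metis atLeastAtMost_iff nat_0_le nat_less_iff order_le_less)
      then show "a n = - \<omega> * cnj (a (int N - 1 - n))"
      proof cases
        case 1
        then show ?thesis using assms(4,5) by simp
      next
        case (2 k)
        then have "a n = b n" using eq by blast
        then show ?thesis unfolding b_def .
      qed
    qed
  qed
  also have "\<dots> \<longleftrightarrow> opuc a N = opuc b N"
    using opuc_cong[of N a b] opuc_inject[of a N b] a by blast
  \<comment> \<open>Both polynomials have degree \<open>N\<close>, while \<open>R\<close> has
    \<open>N + 1\<close> points.\<close>
  also have "\<dots> \<longleftrightarrow> (\<forall>x\<in>R. poly (opuc a N) x = poly (opuc b N) x)"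
    using poly_eqI_degree[of R "opuc a N" "opuc b N"] card by (auto simp: degree_opuc)
  also have "\<dots> \<longleftrightarrow> (\<forall>x\<in>R. opuc_weight a N x =
       complex_of_real (sqrt (opuc_h a N) / cmod (poly (pderiv (opuc a (N + 1))) x)))"
    using weight_iff by simp
  also have "R = z ` {0..N}" using z by (simp add: bij_betw_def)
  finally show ?thesis by (simp only: ball_simps)
qed

end
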